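(* Let $\mathcal{A}$ be a sequential prediction algorithm with constant $\beta$. Let $\delta>\frac{16\beta\ln^2 n}{T}$, and suppose the best expert incurs total cost at most $M\le\frac{\delta^2 T}{128\beta\ln n}$. Then Algorithm B (using $\mathcal{A}$ as its black box) for the online learning with experts problem, on arbitrary-order streams, uses $\widetilde{O}\!\left(\frac{n}{\delta T}\right)$ space and achieves regret at most $\delta$ in expectation.
   Context: Online learning with experts in the (arbitrary-order) streaming model: $n$ experts, $T$ days; on day $t$ the algorithm sees the experts' predictions, follows one of them (its cost is the cost of the expert it follows), then sees the costs $c_i^{(t)}\in[0,1]$ of all experts. Regret is (total cost of the algorithm minus total cost of the best expert)$/T$. A sequential prediction algorithm with constant $\beta$ is an algorithm that, on any experts instance with costs in $[0,1]$ and any target parameter $\varepsilon$, satisfies $\mathbb{E}[\text{cost of }\mathcal{A}]\le(1+\varepsilon)\sum_{t=1}^T c_i^{(t)}+\frac{\beta\ln n}{\varepsilon}$ for every expert $i$, and uses $O(n)$ words of memory. Algorithm B (parameters $n,T,\delta$ and $\mathcal{A}$): set $k\gets\frac{16\beta n\ln n\ln T}{T\delta}$, $u\gets1$; let $P$ be a uniformly random set of $k$ distinct indices of $[n]$ and initialize $\mathcal{A}$ on the experts in $P$ with $\varepsilon=\frac12$. For each day $t\in[T]$: output the prediction of $\mathcal{A}$ running on $P$; if every expert in $P$ has an error rate (average cost) higher than $\frac{\delta}{8}$ since time $u$, let $P$ be a fresh uniformly random set of $k$ distinct indices of $[n]$, set $u\gets t$, and re-initialize $\mathcal{A}$ on $P$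 with $\varepsilon=\frac12$. Space is in words of $O(\log(nT))$ bits; $\widetilde{O}$ hides $\log^{O(1)}(nT)$ factors.
   Formalization: k is rounded up and clipped to [1,n]; when the prescribed k is below 1, the space bound is polylog(nT) words instead of Õ(n/(δT)), which could fall below one word; n ≥ 2 is assumed, and the guarantee of the black box is required only for ε ≤ 1/2. *)

theory Defs
  imports "HOL-Probability.Probability" "HOL-Library.Monad_Syntax"
begin

section \<open>The experts problem\<close>

text \<open>
  A day consists of the predictions of all experts and of their costs (position \<open>i\<close> of
  either list belongs to expert \<open>i\<close>, experts being numbered from \<open>0\<close>).  An instance is the
  list of its days; it is fixed in advance and in arbitrary order, and \<open>T\<close> is its length.
\<close>

type_synonym 'p day = "'p list \<times> real list"

definition experts_instance :: "nat \<Rightarrow> nat \<Rightarrow> 'p day list \<Rightarrow> bool" where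
  "experts_instance n T days \<longleftrightarrow>
     length days = T \<and>
     (\<forall>(x, c) \<in> set days. length x = n \<and> length c = n \<and> (\<forall>r \<in> set c. 0 \<le> r \<and> r \<le> 1))"

definition expert_cost :: "'p day list \<Rightarrow> nat \<Rightarrow> real" where
  "expert_cost days i = (\<Sum>t<length days. snd (days ! t) ! i)"

definition best_cost :: "nat \<Rightarrow> 'p day list \<Rightarrow> real" where
  "best_cost n days = Min (expert_cost days ` {..<n})"

text \<open>
  A randomized online algorithm with memory states \<open>'s\<close>.  On each day \<open>decide\<close> sees the
  predictions and returns the expert that is followed, and afterwards \<open>observe\<close> sees the
  costs; both may change the memory.  \<open>words s\<close> is the number of machine words (of
  \<open>O(log (nT))\<close> bits) occupied by the memory state \<open>s\<close>.
\<close>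

record ('s, 'p) expert_alg =
  start :: "'s pmf"
  decide :: "'s \<Rightarrow> 'p list \<Rightarrow> (nat \<times> 's) pmf"
  observe :: "'s \<Rightarrow> real list \<Rightarrow> 's pmf"
  words :: "'s \<Rightarrow> nat"

text \<open>Joint distribution of the experts followed and of all memory states passed through.\<close>

fun play_from :: "('s, 'p) expert_alg \<Rightarrow> 's \<Rightarrow> 'p day list \<Rightarrow> (nat list \<times> 's list) pmf" where
  "play_from B s [] = return_pmf ([], [s])"
| "play_from B s ((x, c) # days) =
     do {
       (i, s') \<leftarrow> decide B s x;
       s'' \<leftarrow> observe B s' c;
       (is, ss) \<leftarrow> play_from B s'' days;
       return_pmf (i # is, s # s' # ss)
     }"

definition play :: "('s, 'p) expert_alg \<Rightarrow> 'p day list \<Rightarrow> (nat list \<times> 's list) pmf" where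
  "play B days = do { s \<leftarrow> start B; play_from B s days }"

definition followed_cost :: "'p day list \<Rightarrow> nat list \<Rightarrow> real" where
  "followed_cost days is = (\<Sum>t<length days. snd (days ! t) ! (is ! t))"

definition regret :: "nat \<Rightarrow> 'p day list \<Rightarrow> nat list \<Rightarrow> real" where
  "regret n days is = (followed_cost days is - best_cost n days) / real (length days)"

definition expected_cost :: "('s, 'p) expert_alg \<Rightarrow> 'p day list \<Rightarrow> real" where
  "expected_cost B days =
     measure_pmf.expectation (play B days) (\<lambda>(is, ss). followed_cost days is)"

definition expected_regret :: "('s, 'p) expert_alg \<Rightarrow> nat \<Rightarrow> 'p day list \<Rightarrow> real" where
  "expected_regret B n days =
     measure_pmf.expectation (play B days) (\<lambda>(is, ss). regret n days is)"

definition uses_space :: "('s, 'p) expert_alg \<Rightarrow> 'p day list \<Rightarrow> real \<Rightarrow> bool" where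
  "uses_space B days S \<longleftrightarrow>
     (\<forall>(is, ss) \<in> set_pmf (play B days). \<forall>s \<in> set ss. real (words B s) \<le> S)"

definition follows_experts :: "('s, 'p) expert_alg \<Rightarrow> nat \<Rightarrow> 'p day list \<Rightarrow> bool" where
  "follows_experts B n days \<longleftrightarrow>
     (\<forall>(is, ss) \<in> set_pmf (play B days). \<forall>i \<in> set is. i < n)"


section \<open>Sequential prediction algorithms\<close>

text \<open>
  \<open>A n \<epsilon>\<close> is the algorithm initialized on \<open>n\<close> experts with target parameter \<open>\<epsilon>\<close>; it is not
  told the number of days.  As usual for such guarantees \<open>\<epsilon>\<close> is at most \<open>1/2\<close>: for
  \<open>\<epsilon> \<rightarrow> \<infinity>\<close> and a best expert of cost \<open>0\<close> no algorithm could satisfy the cost bound.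
\<close>

definition sequential_prediction_alg ::
    "real \<Rightarrow> (nat \<Rightarrow> real \<Rightarrow> ('s, 'p) expert_alg) \<Rightarrow> bool" where
  "sequential_prediction_alg \<beta> A \<longleftrightarrow>
     0 < \<beta> \<and>
     (\<forall>n T \<epsilon> days. 1 \<le> n \<longrightarrow> 0 < \<epsilon> \<longrightarrow> \<epsilon> \<le> 1/2 \<longrightarrow> experts_instance n T days \<longrightarrow>
        follows_experts (A n \<epsilon>) n days \<and>
        (\<forall>i<n. expected_cost (A n \<epsilon>) days
                 \<le> (1 + \<epsilon>) * expert_cost days i + \<beta> * ln (real n) / \<epsilon>)) \<and>
     (\<exists>C. \<forall>n T \<epsilon> days. 1 \<le> n \<longrightarrow> 0 < \<epsilon> \<longrightarrow> \<epsilon> \<le> 1/2 \<longrightarrow> experts_instance n T days \<longrightarrow>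
        uses_space (A n \<epsilon>) days (C * real n))"


section \<open>Algorithm B\<close>

definition sample_param :: "real \<Rightarrow> nat \<Rightarrow> nat \<Rightarrow> real \<Rightarrow> real" where
  "sample_param \<beta> n T \<delta> = 16 * \<beta> * real n * ln (real n) * ln (real T) / (real T * \<delta>)"

text \<open>
  A set of \<open>k\<close> distinct experts exists and is nonempty only for integers \<open>1 \<le> k \<le> n\<close>, so
  \<open>sample_param\<close> is rounded up and clipped to this range.
\<close>

definition sample_size :: "real \<Rightarrow> nat \<Rightarrow> nat \<Rightarrow> real \<Rightarrow> nat" where
  "sample_size \<beta> n T \<delta> = min n (max 1 (nat \<lceil>sample_param \<beta> n T \<delta>\<rceil>))"

text \<open>
  \<open>pool\<close> lists the set \<open>P\<close>, \<open>loss\<close> the costs of its members accumulated since \<open>P\<close> was drawn,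
  \<open>today\<close> is the number of completed days and \<open>since\<close> its value when \<open>P\<close> was drawn; thus
  \<open>P\<close> is judged on the days following its draw.
\<close>

record 's B_state =
  pool :: "nat list"
  loss :: "real list"
  since :: nat
  today :: nat
  inner :: 's

definition B_fresh ::
    "nat \<Rightarrow> nat \<Rightarrow> ('s, 'p) expert_alg \<Rightarrow> nat \<Rightarrow> 's B_state pmf" where
  "B_fresh n k A t =
     do {
       P \<leftarrow> pmf_of_set {P. P \<subseteq> {..<n} \<and> card P = k};
       s \<leftarrow> start A;
       return_pmf \<lparr> pool = sorted_list_of_set P, loss = replicate k 0,
                    since = t, today = t, inner = s \<rparr>
     }"

definition B_decide ::
    "('s, 'p) expert_alg \<Rightarrow> 's B_state \<Rightarrow> 'p list \<Rightarrow> (nat \<times> 's B_state) pmf" where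
  "B_decide A b x =
     do {
       (j, s) \<leftarrow> decide A (inner b) (map ((!) x) (pool b));
       return_pmf (pool b ! j, b\<lparr> inner := s \<rparr>)
     }"

definition B_observe ::
    "nat \<Rightarrow> nat \<Rightarrow> real \<Rightarrow> ('s, 'p) expert_alg \<Rightarrow> 's B_state \<Rightarrow> real list \<Rightarrow> 's B_state pmf" where
  "B_observe n k \<delta> A b c =
     (let cP = map ((!) c) (pool b);
          l = map2 (+) (loss b) cP;
          t = Suc (today b)
      in if \<forall>r \<in> set l. r / real (t - since b) > \<delta> / 8
         then B_fresh n k A t
         else do {
           s \<leftarrow> observe A (inner b) cP;
           return_pmf (b\<lparr> loss := l, today := t, inner := s \<rparr>)
         })"

text \<open>
  The summands are: the memory of the black box; the set \<open>P\<close>; the accumulated costs; room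
  for the entries of the current day that belong to \<open>P\<close>; the two time counters and the
  parameters \<open>\<beta>\<close>, \<open>n\<close>, \<open>T\<close>, \<open>\<delta>\<close>.
\<close>

definition B_words :: "('s, 'p) expert_alg \<Rightarrow> 's B_state \<Rightarrow> nat" where
  "B_words A b =
     words A (inner b) + length (pool b) + length (loss b) + length (pool b) + 2 + 4"

definition algorithm_B ::
    "real \<Rightarrow> nat \<Rightarrow> nat \<Rightarrow> real \<Rightarrow> (nat \<Rightarrow> real \<Rightarrow> ('s, 'p) expert_alg) \<Rightarrow>
     ('s B_state, 'p) expert_alg" where
  "algorithm_B \<beta> n T \<delta> A =
     (let k = sample_size \<beta> n T \<delta>; A\<^sub>P = A k (1/2)
      in \<lparr> start = B_fresh n k A\<^sub>P 0,
           decide = B_decide A\<^sub>P,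
           observe = B_observe n k \<delta> A\<^sub>P,
           words = B_words A\<^sub>P \<rparr>)"

end

theory Submission
  imports Defs
begin

text \<open>
  Given the set drawn on some day, both the day on which it is rejected and the instance on which
  the black box runs until then are determined. On such a phase some member of the set has an
  average cost of at most \<open>\<delta>/8\<close> until the day before the rejection, which bounds the cost of the
  black box.

  It remains to bound the number of phases. Fix a best expert \<open>i\<close> and call a day bad if the average
  cost of \<open>i\<close> over some period beginning on that day exceeds \<open>\<delta>/8\<close>. By a maximal inequality there
  are at most \<open>8M/\<delta>\<close> bad days. A set drawn on another day is never rejected if it contains \<open>i\<close>,
  which has probability \<open>k/n\<close>. So the expected number of draws is at most \<open>8M/\<delta> + n/k\<close>.
  The rejection days cost at most 1 each; this is affordable because any sequential prediction
  algorithm has \<open>\<beta> \<ge> 1 / (4 ln 2)\<close>.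
\<close>

section \<open>Costs as nonnegative integrals\<close>

text \<open>Following an expert that does not exist is charged \<open>\<infinity>\<close>, instead of the junk value of \<open>!\<close>.\<close>

definition charge :: "real list \<Rightarrow> nat \<Rightarrow> ennreal" where
  "charge c i = (if i < length c then ennreal (c ! i) else \<infinity>)"

definition total_charge :: "'p day list \<Rightarrow> nat list \<Rightarrow> ennreal" where
  "total_charge days is = (\<Sum>t<length days. charge (snd (days ! t)) (is ! t))"

text \<open>Nonnegative extended integrals exist without integrability conditions, so the inductions
  over days and over redraws can use them freely. Finiteness returns only where a guarantee on
  \<open>expected_cost\<close> enters.\<close>

fun cost_from :: "('s, 'p) expert_alg \<Rightarrow> 's \<Rightarrow> 'p day list \<Rightarrow> ennreal" where
  "cost_from A s [] = 0"
| "cost_from A s ((x, c) # days) =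
     (\<integral>\<^sup>+ (i, s'). charge c i + (\<integral>\<^sup>+ s''. cost_from A s'' days \<partial>observe A s' c) \<partial>decide A s x)"

definition cost :: "('s, 'p) expert_alg \<Rightarrow> 'p day list \<Rightarrow> ennreal" where
  "cost A days = (\<integral>\<^sup>+ s. cost_from A s days \<partial>start A)"

lemma total_charge_Nil [simp]: "total_charge [] is = 0"
  by (simp add: total_charge_def)

lemma total_charge_Cons [simp]:
  "total_charge ((x, c) # days) (i # is) = charge c i + total_charge days is"
  by (simp add: total_charge_def sum.lessThan_Suc_shift del: sum.lessThan_Suc)

lemma nn_integral_add_const_pmf:
  "(\<integral>\<^sup>+ x. c + f x \<partial>measure_pmf p) = c + (\<integral>\<^sup>+ x. f x \<partial>measure_pmf p)" for c :: ennreal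
  by (simp add: nn_integral_add)

lemma nn_integral_add_const_pmf':
  "(\<integral>\<^sup>+ x. f x + c \<partial>measure_pmf p) = (\<integral>\<^sup>+ x. f x \<partial>measure_pmf p) + c" for c :: ennreal
  by (simp add: nn_integral_add)

lemma nn_integral_pmf_mono:
  assumes "\<And>x. x \<in> set_pmf p \<Longrightarrow> f x \<le> g x"
  shows "(\<integral>\<^sup>+ x. f x \<partial>measure_pmf p) \<le> (\<integral>\<^sup>+ x. g x \<partial>measure_pmf p)"
  using assms by (intro nn_integral_mono_AE) (auto simp: AE_measure_pmf_iff)

lemma nn_integral_pmf_le_const:
  fixes c :: ennreal
  assumes "\<And>x. x \<in> set_pmf p \<Longrightarrow> f x \<le> c"
  shows "(\<integral>\<^sup>+ x. f x \<partial>measure_pmf p) \<le> c"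
  using nn_integral_pmf_mono[of p f "\<lambda>_. c"] assms by simp

lemma cost_from_eq: "cost_from A s days = (\<integral>\<^sup>+ (is, ss). total_charge days is \<partial>play_from A s days)"
proof (induction days arbitrary: s)
  case Nil
  then show ?case by simp
next
  case (Cons d days)
  obtain x c where d: "d = (x, c)" by force
  show ?case
    by (simp add: d Cons.IH case_prod_unfold nn_integral_add_const_pmf)
qed

lemma cost_eq: "cost A days = (\<integral>\<^sup>+ (is, ss). total_charge days is \<partial>play A days)"
  by (simp add: cost_def play_def cost_from_eq)

lemma charge_le_zero_charge:
  assumes "\<forall>r \<in> set c. r \<le> 1"
  shows "charge c i \<le> charge (replicate (length c) 0) i + 1"
  using assms by (auto simp: charge_def)

text \<open>The followed expert is chosen before the costs of the day are seen, so the costs of the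
  last day influence only the charge of that day.\<close>

lemma cost_from_last_day:
  assumes "\<forall>r \<in> set c. r \<le> 1"
  shows "cost_from A s (days @ [(x, c)])
           \<le> cost_from A s (days @ [(x, replicate (length c) 0)]) + 1"
proof (induction days arbitrary: s)
  case Nil
  have "cost_from A s [(x, c)] \<le>
      (\<integral>\<^sup>+ z. charge (replicate (length c) 0) (fst z) + 1 \<partial>decide A s x)"
    using charge_le_zero_charge[OF assms]
    by (auto simp: case_prod_unfold intro!: nn_integral_pmf_mono)
  then show ?case
    by (simp add: case_prod_unfold nn_integral_add_const_pmf')
next
  case (Cons d days)
  obtain y b where d: "d = (y, b)" by force
  have "cost_from A s ((d # days) @ [(x, c)]) \<le>
    (\<integral>\<^sup>+ z. (charge b (fst z) + (\<integral>\<^sup>+ s''. cost_from A s'' (days @ [(x, replicate (length c) 0)])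
        \<partial>observe A (snd z) b)) + 1 \<partial>decide A s y)"
    unfolding d append_Cons cost_from.simps case_prod_unfold
    unfolding add.assoc nn_integral_add_const_pmf'[symmetric]
    by (intro nn_integral_pmf_mono add_left_mono Cons.IH)
  then show ?case
    by (simp add: case_prod_unfold nn_integral_add_const_pmf' d)
qed

lemma cost_last_day:
  assumes "\<forall>r \<in> set c. r \<le> 1"
  shows "cost A (days @ [(x, c)]) \<le> cost A (days @ [(x, replicate (length c) 0)]) + 1"
  unfolding cost_def nn_integral_add_const_pmf'[symmetric]
  by (intro nn_integral_pmf_mono cost_from_last_day assms)

lemma play_from_length:
  "(is, ss) \<in> set_pmf (play_from A s days) \<Longrightarrow> length is = length days"
proof (induction days arbitrary: s "is" ss)
  case (Cons d days)
  then show ?case by (cases d) fastforce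
qed simp

lemma play_length: "(is, ss) \<in> set_pmf (play A days) \<Longrightarrow> length is = length days"
  by (auto simp: play_def play_from_length)

section \<open>Comparison with the real-valued expected cost and regret\<close>

lemma experts_instance_nth:
  assumes "experts_instance n T days" "t < T"
  shows "length (fst (days ! t)) = n" "length (snd (days ! t)) = n"
    "\<And>i. i < n \<Longrightarrow> 0 \<le> snd (days ! t) ! i \<and> snd (days ! t) ! i \<le> 1"
  using assms nth_mem[of t days] unfolding experts_instance_def
  by (fastforce simp: case_prod_unfold)+

lemma total_charge_eq:
  assumes "experts_instance n T days" "length is = length days" "\<forall>i \<in> set is. i < n"
  shows "total_charge days is = ennreal (followed_cost days is)"
    and "0 \<le> followed_cost days is" and "followed_cost days is \<le> real T"
proof -
  have T: "length days = T" using assms(1) by (simp add: experts_instance_def)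
  have i: "is ! t < n" if "t < T" for t using assms T that by auto
  show "total_charge days is = ennreal (followed_cost days is)"
    unfolding total_charge_def followed_cost_def T
    by (subst sum_ennreal[symmetric])
      (auto simp: charge_def i experts_instance_nth[OF assms(1)])
  show "0 \<le> followed_cost days is"
    unfolding followed_cost_def T
    by (auto intro!: sum_nonneg simp: experts_instance_nth[OF assms(1)] i)
  have "followed_cost days is \<le> (\<Sum>t<T. 1)"
    unfolding followed_cost_def T
    by (intro sum_mono) (auto simp: experts_instance_nth[OF assms(1)] i)
  then show "followed_cost days is \<le> real T" by simp
qed

text \<open>As long as only existing experts are followed, no charge is infinite and the total lies
  between 0 and \<open>T\<close>, so the Bochner integral exists and has the same value.\<close>

lemma cost_eq_expected_cost:
  assumes "experts_instance n T days" "follows_experts A n days"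
  shows "cost A days = ennreal (expected_cost A days)"
proof -
  have *: "total_charge days is = ennreal (followed_cost days is) \<and>
      0 \<le> followed_cost days is \<and> followed_cost days is \<le> real T"
    if "(is, ss) \<in> set_pmf (play A days)" for "is" ss
    using total_charge_eq[OF assms(1), of "is"] play_length[OF that] assms(2) that
    by (auto simp: follows_experts_def)
  have "cost A days = (\<integral>\<^sup>+ z. ennreal (followed_cost days (fst z)) \<partial>play A days)"
    unfolding cost_eq
    by (intro nn_integral_cong_AE) (auto simp: AE_measure_pmf_iff *)
  also have "\<dots> = ennreal (expected_cost A days)"
    unfolding expected_cost_def case_prod_unfold
    by (intro nn_integral_eq_integral measure_pmf.integrable_const_bound[where B = "real T"])
      (auto simp: AE_measure_pmf_iff dest!: *)
  finally show ?thesis .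
qed

lemma cost_le_length:
  assumes "experts_instance n T days" "follows_experts A n days"
  shows "cost A days \<le> ennreal (real T)"
  unfolding cost_eq
  using total_charge_eq[OF assms(1)] play_length[of _ _ A days] assms(2)
  by (intro nn_integral_pmf_le_const) (fastforce simp: follows_experts_def intro!: ennreal_leI)

text \<open>Since the best cost is nonnegative, the regret is at most the followed cost over
  \<open>T\<close>; and a charge bounds the recorded cost for every followed number, existing or
  not.\<close>

lemma expected_regret_le:
  assumes "experts_instance n T days" "0 < T" "0 \<le> best_cost n days"
    and "cost B days \<le> ennreal (\<delta> * real T)" "0 \<le> \<delta>"
  shows "expected_regret B n days \<le> \<delta>"
proof -
  have T: "length days = T" using assms(1) by (simp add: experts_instance_def)
  have charge: "ennreal (c ! i) \<le> charge c i" for c i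
    by (simp add: charge_def)
  have "(\<integral>\<^sup>+ z. ennreal (regret n days (fst z)) \<partial>play B days)
      \<le> (\<integral>\<^sup>+ z. ennreal (1 / real T) * total_charge days (fst z) \<partial>play B days)"
  proof (rule nn_integral_pmf_mono)
    fix z
    have "ennreal (regret n days (fst z)) \<le> ennreal (1 / real T * followed_cost days (fst z))"
      using assms by (intro ennreal_leI) (simp add: regret_def T divide_right_mono)
    also have "\<dots> = ennreal (1 / real T) * ennreal (followed_cost days (fst z))"
      by (rule ennreal_mult') simp
    \<comment> \<open>An entry read outside the list may be negative; positive parts make all
      summands nonnegative, so that \<open>ennreal\<close> commutes with the sum.\<close>
    also have "ennreal (followed_cost days (fst z))
        \<le> ennreal (\<Sum>t<length days. max 0 (snd (days ! t) ! (fst z ! t)))"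
      unfolding followed_cost_def by (intro ennreal_leI sum_mono) auto
    also have "\<dots> \<le> total_charge days (fst z)"
      unfolding total_charge_def
      by (subst sum_ennreal[symmetric])
        (auto intro!: sum_mono charge simp: max_def ennreal_neg simp del: sum_ennreal)
    finally show "ennreal (regret n days (fst z)) \<le>
        ennreal (1 / real T) * total_charge days (fst z)"
      by (simp add: mult_left_mono)
  qed
  also have "\<dots> = ennreal (1 / real T) * cost B days"
    unfolding cost_eq case_prod_unfold by (simp add: nn_integral_cmult)
  also have "\<dots> \<le> ennreal (1 / real T) * ennreal (\<delta> * real T)"
    by (intro mult_left_mono assms) simp
  also have "\<dots> = ennreal \<delta>"
    using assms by (simp flip: ennreal_mult)
  \<comment> \<open>\<open>ennreal\<close> truncates the regret to its positive part. A bound on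
    that integral bounds the Bochner integral, also in the non-integrable case, where the latter is
    0.\<close>
  finally show ?thesis
    unfolding expected_regret_def case_prod_unfold
    by (intro integral_real_bounded assms)
qed

section \<open>Guarantees of the black box at target parameter 1/2\<close>

lemma sequential_prediction_cost_le:
  assumes "sequential_prediction_alg \<beta> A" "1 \<le> k" "experts_instance k T days" "j < k"
  shows "cost (A k (1/2)) days \<le> ennreal (3/2 * expert_cost days j + 2 * \<beta> * ln (real k))"
proof -
  have "follows_experts (A k (1/2)) k days"
    "expected_cost (A k (1/2)) days
       \<le> (1 + 1/2) * expert_cost days j + \<beta> * ln (real k) / (1/2)"
    using assms(1)[unfolded sequential_prediction_alg_def, THEN conjunct2, THEN conjunct1,
        rule_format, of k "1/2" T days] assms(2-4) by auto
  then show ?thesis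
    unfolding cost_eq_expected_cost[OF assms(3) \<open>follows_experts (A k (1/2)) k days\<close>]
    by (intro ennreal_leI) (simp add: algebra_simps)
qed

lemma sequential_prediction_follows:
  assumes "sequential_prediction_alg \<beta> A" "1 \<le> k" "experts_instance k T days"
  shows "follows_experts (A k (1/2)) k days"
  using assms(1)[unfolded sequential_prediction_alg_def, THEN conjunct2, THEN conjunct1,
        rule_format, of k "1/2" T days] assms(2,3) by auto

text \<open>Of two experts one errs and the other does not, and the algorithm cannot tell which.\<close>

lemma sequential_prediction_constant_ge:
  fixes A :: "nat \<Rightarrow> real \<Rightarrow> ('s, 'p) expert_alg"
  assumes "sequential_prediction_alg \<beta> A"
  shows "1 \<le> 4 * \<beta> * ln 2"
proof -
  define x :: "'p list" where "x = replicate 2 undefined"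
  have inst: "experts_instance 2 1 [(x, [1, 0])]" "experts_instance 2 1 [(x, [0, 1])]"
    by (auto simp: experts_instance_def x_def)
  have \<beta>: "0 < \<beta>" using assms by (simp add: sequential_prediction_alg_def)
  have "1 \<le> (\<integral>\<^sup>+ s. (\<integral>\<^sup>+ z. 1 \<partial>decide (A 2 (1/2)) s x) \<partial>start (A 2 (1/2)))"
    by simp
  \<comment> \<open>The decision has the same distribution in both scenarios. An existing expert is
    charged 1 in one of them, any other number infinitely.\<close>
  also have "\<dots> \<le> (\<integral>\<^sup>+ s. (\<integral>\<^sup>+ z. charge [1, 0] (fst z) + charge [0, 1] (fst z)
      \<partial>decide (A 2 (1/2)) s x) \<partial>start (A 2 (1/2)))"
    by (intro nn_integral_pmf_mono) (auto simp: charge_def less_Suc_eq)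
  also have "\<dots> = cost (A 2 (1/2)) [(x, [1, 0])] + cost (A 2 (1/2)) [(x, [0, 1])]"
    by (simp add: cost_def case_prod_unfold nn_integral_add)
  \<comment> \<open>Each scenario is compared with its expert of cost 0, which leaves only \<beta>
    ln 2 / (1/2).\<close>
  also have "\<dots> \<le> ennreal (2 * \<beta> * ln 2) + ennreal (2 * \<beta> * ln 2)"
    using sequential_prediction_cost_le[OF assms _ inst(1), of 1]
      sequential_prediction_cost_le[OF assms _ inst(2), of 0]
    by (intro add_mono) (auto simp: expert_cost_def)
  also have "\<dots> = ennreal (4 * \<beta> * ln 2)"
    using \<beta> by (simp flip: ennreal_plus)
  finally show ?thesis
    by (simp add: ennreal_ge_1)
qed


section \<open>Phases of Algorithm B\<close>

text \<open>Detached from \<open>sample_size\<close> and from the family of black boxes, so that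
  \<open>k\<close> and one initialized black box are free parameters of the phase analysis.\<close>

definition B_alg :: "nat \<Rightarrow> nat \<Rightarrow> real \<Rightarrow> ('s, 'p) expert_alg \<Rightarrow> ('s B_state, 'p) expert_alg" where
  "B_alg n k \<delta> A = \<lparr>start = B_fresh n k A 0, decide = B_decide A,
     observe = B_observe n k \<delta> A, words = B_words A\<rparr>"

lemma B_alg_sel [simp]:
  "start (B_alg n k \<delta> A) = B_fresh n k A 0" "decide (B_alg n k \<delta> A) = B_decide A"
  "observe (B_alg n k \<delta> A) = B_observe n k \<delta> A" "words (B_alg n k \<delta> A) = B_words A"
  by (simp_all add: B_alg_def)

lemma algorithm_B_eq:
  "algorithm_B \<beta> n T \<delta> A =
     B_alg n (sample_size \<beta> n T \<delta>) \<delta> (A (sample_size \<beta> n T \<delta>) (1/2))"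
  by (simp add: algorithm_B_def B_alg_def Let_def)

text \<open>A draw forgets everything but the day counter, so the cost still to come after a redraw
  depends on the remaining days and \<open>t\<close> alone; the later inductions rest on
  this.\<close>

definition cost_after_draw ::
    "nat \<Rightarrow> nat \<Rightarrow> real \<Rightarrow> ('s, 'p) expert_alg \<Rightarrow> nat \<Rightarrow> 'p day list \<Rightarrow> ennreal" where
  "cost_after_draw n k \<delta> A t days =
     (\<integral>\<^sup>+ b. cost_from (B_alg n k \<delta> A) b days \<partial>B_fresh n k A t)"

definition restrict_day :: "nat list \<Rightarrow> 'p day \<Rightarrow> 'p day" where
  "restrict_day P d = (map ((!) (fst d)) P, map ((!) (snd d)) P)"

text \<open>Here \<open>days\<close> are those since the draw, the current one included. For
  \<open>[]\<close> the quotient is 0 by convention on division by zero, so the phase lemmas treat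
  that case separately.\<close>

definition rejects :: "real \<Rightarrow> nat list \<Rightarrow> 'p day list \<Rightarrow> bool" where
  "rejects \<delta> P days \<longleftrightarrow> (\<forall>p \<in> set P. expert_cost days p / real (length days) > \<delta> / 8)"

section \<open>Expert costs on concatenated and restricted instances\<close>

lemma expert_cost_Nil [simp]: "expert_cost [] i = 0"
  by (simp add: expert_cost_def)

lemma expert_cost_append:
  "expert_cost (days @ days') i = expert_cost days i + expert_cost days' i"
proof -
  have "expert_cost (days @ days') i = (\<Sum>t<length days. snd ((days @ days') ! t) ! i)
      + (\<Sum>t = length days..<length days + length days'. snd ((days @ days') ! t) ! i)"
    unfolding expert_cost_def
    by (simp add: sum.atLeastLessThan_concat flip: atLeast0LessThan)
  also have "(\<Sum>t = length days..<length days + length days'. snd ((days @ days') ! t) ! i)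
      = expert_cost days' i"
    using sum.shift_bounds_nat_ivl[of "\<lambda>t. snd ((days @ days') ! t) ! i" 0 "length days" "length days'"]
    by (simp add: expert_cost_def add.commute atLeast0LessThan nth_append)
  finally show ?thesis
    by (simp add: expert_cost_def nth_append)
qed

lemma expert_cost_Cons [simp]: "expert_cost (d # days) i = snd d ! i + expert_cost days i"
  using expert_cost_append[of "[d]" days i] by (simp add: expert_cost_def)

lemma expert_cost_restrict_day:
  "j < length P \<Longrightarrow> expert_cost (map (restrict_day P) days) j = expert_cost days (P ! j)"
  by (induction days) (simp_all add: restrict_day_def)

lemma experts_instance_append:
  "experts_instance n T (days @ days') \<longleftrightarrow>
     (\<exists>T1 T2. T = T1 + T2 \<and> experts_instance n T1 days \<and> experts_instance n T2 days')"
  unfolding experts_instance_def by (simp add: ball_Un) blast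

lemma experts_instance_Cons:
  "experts_instance n T (d # days) \<longleftrightarrow>
     length (fst d) = n \<and> length (snd d) = n \<and> (\<forall>r \<in> set (snd d). 0 \<le> r \<and> r \<le> 1) \<and>
     (\<exists>T'. T = Suc T' \<and> experts_instance n T' days)"
  by (auto simp: experts_instance_def)

lemma experts_instance_restrict:
  assumes "experts_instance n T days" "set P \<subseteq> {..<n}"
  shows "experts_instance (length P) T (map (restrict_day P) days)"
  using assms by (fastforce simp: experts_instance_def restrict_day_def)

lemma expert_cost_nonneg:
  assumes "experts_instance n T days" "i < n"
  shows "0 \<le> expert_cost days i"
  using assms experts_instance_nth(3)[OF assms(1)]
  by (auto simp: expert_cost_def experts_instance_def intro!: sum_nonneg)

text \<open>Fixes every component except \<open>inner\<close>: the others are functions of the drawn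
  set and the costs since the draw, and the black box influences \<open>inner\<close> only.\<close>

definition B_tracks :: "nat list \<Rightarrow> nat \<Rightarrow> 'p day list \<Rightarrow> 's B_state \<Rightarrow> bool" where
  "B_tracks P u past b \<longleftrightarrow> pool b = P \<and> loss b = map (expert_cost past) P \<and>
     since b = u \<and> today b = u + length past"

lemma B_observe_tracked:
  assumes "B_tracks P u past b"
  shows "B_observe n k \<delta> A b c =
    (if rejects \<delta> P (past @ [(x, c)]) then B_fresh n k A (u + length (past @ [(x, c)]))
     else do {
       s \<leftarrow> observe A (inner b) (map ((!) c) P);
       return_pmf (b\<lparr> loss := map (expert_cost (past @ [(x, c)])) P,
                     today := u + length (past @ [(x, c)]), inner := s \<rparr>)
     })"
proof -
  have P: "pool b = P" using assms by (simp add: B_tracks_def)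
  have l: "map2 (+) (loss b) (map ((!) c) P) = map (expert_cost (past @ [(x, c)])) P"
    using assms by (auto simp: B_tracks_def expert_cost_append intro!: nth_equalityI)
  have t: "Suc (today b) - since b = length (past @ [(x, c)])"
    "Suc (today b) = u + length (past @ [(x, c)])"
    using assms by (simp_all add: B_tracks_def)
  show ?thesis
    unfolding B_observe_def Let_def P unfolding l t(1) unfolding t(2) rejects_def by simp
qed

lemma cost_from_B_Cons:
  assumes "B_tracks P u past b" "set P \<subseteq> {..<n}" "length c = n"
  shows "cost_from (B_alg n k \<delta> A) b ((x, c) # days) \<le>
    (\<integral>\<^sup>+ (j, s). charge (map ((!) c) P) j +
       (if rejects \<delta> P (past @ [(x, c)])
        then cost_after_draw n k \<delta> A (u + length (past @ [(x, c)])) days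
        else \<integral>\<^sup>+ s'. cost_from (B_alg n k \<delta> A)
               (b\<lparr> loss := map (expert_cost (past @ [(x, c)])) P,
                  today := u + length (past @ [(x, c)]), inner := s'\<rparr>) days
             \<partial>observe A s (map ((!) c) P))
     \<partial>decide A (inner b) (map ((!) x) P))"
proof -
  have P: "pool b = P" using assms by (simp add: B_tracks_def)
  have tr: "B_tracks P u past (b\<lparr>inner := s\<rparr>)" for s
    using assms(1) by (simp add: B_tracks_def)
  \<comment> \<open>If \<open>j\<close> is no position of \<open>P\<close>, then
    \<open>P ! j\<close> is a junk value, but the right side is infinite; hence an inequality in the
    conclusion.\<close>
  have ch: "charge c (P ! j) \<le> charge (map ((!) c) P) j" for j
    using assms(2,3) by (auto simp: charge_def subset_iff)
  have ob: "(\<integral>\<^sup>+ b'. cost_from (B_alg n k \<delta> A) b' days \<partial>B_observe n k \<delta> A (b\<lparr>inner := s\<rparr>) c) =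
      (if rejects \<delta> P (past @ [(x, c)])
        then cost_after_draw n k \<delta> A (u + length (past @ [(x, c)])) days
        else \<integral>\<^sup>+ s'. cost_from (B_alg n k \<delta> A)
               (b\<lparr> loss := map (expert_cost (past @ [(x, c)])) P,
                  today := u + length (past @ [(x, c)]), inner := s'\<rparr>) days
             \<partial>observe A s (map ((!) c) P))" for s
    unfolding B_observe_tracked[OF tr, where x = x]
    by (simp add: cost_after_draw_def)
  show ?thesis
    by (simp add: B_decide_def P case_prod_unfold)
      (auto simp: ob[simplified] intro!: nn_integral_pmf_mono add_mono ch)
qed

text \<open>The drawn set is rejected on a day that is determined by the set alone, whatever the black
  box does, so between two draws the black box runs on a fixed instance.\<close>

lemma B_phase_from:
  assumes "experts_instance n T days" "set P \<subseteq> {..<n}"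
  shows "((past @ days = [] \<or> days = [] \<or> \<not> rejects \<delta> P (past @ days)) \<and>
      (\<forall>b. B_tracks P u past b \<longrightarrow> cost_from (B_alg n k \<delta> A) b days
         \<le> cost_from A (inner b) (map (restrict_day P) days))) \<or>
    (\<exists>days1 d days2. days = days1 @ d # days2 \<and> rejects \<delta> P (past @ days1 @ [d]) \<and>
      (days1 = [] \<or> \<not> rejects \<delta> P (past @ days1)) \<and>
      (\<forall>b. B_tracks P u past b \<longrightarrow> cost_from (B_alg n k \<delta> A) b days
         \<le> cost_from A (inner b) (map (restrict_day P) (days1 @ [d]))
            + cost_after_draw n k \<delta> A (u + length (past @ days1 @ [d])) days2))"
  using assms(1)
proof (induction days arbitrary: past T)
  case Nil
  then show ?case by simp
next
  case (Cons d days)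
  obtain x c where d: "d = (x, c)" by force
  have c: "length c = n" using Cons.prems by (simp add: d experts_instance_Cons)
  note step = cost_from_B_Cons[OF _ assms(2) c]
  show ?case
  proof (cases "rejects \<delta> P (past @ [d])")
    case True
    \<comment> \<open>On rejection the black box is not shown the costs of the day. This changes
      nothing, because its own instance ends with that day and only the charge of the decision
      counts.\<close>
    have "cost_from (B_alg n k \<delta> A) b (d # days)
         \<le> cost_from A (inner b) (map (restrict_day P) [d])
            + cost_after_draw n k \<delta> A (u + length (past @ [d])) days"
      if "B_tracks P u past b" for b
      using step[OF that, of k \<delta> A x days] True
      by (simp add: d restrict_day_def case_prod_unfold nn_integral_add_const_pmf')
    then have "\<exists>days1 d' days2. d # days = days1 @ d' # days2 \<and>
      rejects \<delta> P (past @ days1 @ [d']) \<and>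
      (days1 = [] \<or> \<not> rejects \<delta> P (past @ days1)) \<and>
      (\<forall>b. B_tracks P u past b \<longrightarrow> cost_from (B_alg n k \<delta> A) b (d # days)
         \<le> cost_from A (inner b) (map (restrict_day P) (days1 @ [d']))
            + cost_after_draw n k \<delta> A (u + length (past @ days1 @ [d'])) days2)"
      using True by (intro exI[of _ "[]"] exI[of _ d] exI[of _ days]) simp
    then show ?thesis by blast
  next
    case False
    \<comment> \<open>\<open>X\<close> stands for the cost after the next draw, or 0 if the set is
      kept, so that one inequality prepends the day in both situations.\<close>
    have step': "cost_from (B_alg n k \<delta> A) b (d # days)
         \<le> cost_from A (inner b) (map (restrict_day P) (d # days1)) + X"
      if b: "B_tracks P u past b" and
        le: "\<And>b. B_tracks P u (past @ [d]) b \<Longrightarrow> cost_from (B_alg n k \<delta> A) b days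
          \<le> cost_from A (inner b) (map (restrict_day P) days1) + X" for b days1 X
    proof -
      define b' where "b' s = b\<lparr>loss := map (expert_cost (past @ [d])) P,
                  today := u + length (past @ [d]), inner := s\<rparr>" for s
      have b': "B_tracks P u (past @ [d]) (b' s)" "inner (b' s) = s" for s
        using b by (simp_all add: B_tracks_def b'_def)
      have "cost_from (B_alg n k \<delta> A) b (d # days) \<le>
         (\<integral>\<^sup>+ (j, s). charge (map ((!) c) P) j +
           (\<integral>\<^sup>+ s'. cost_from (B_alg n k \<delta> A) (b' s') days \<partial>observe A s (map ((!) c) P))
         \<partial>decide A (inner b) (map ((!) x) P))"
        using step[OF b, of k \<delta> A x days] False by (simp add: d b'_def)
      also have "\<dots> \<le> (\<integral>\<^sup>+ (j, s). charge (map ((!) c) P) j +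
           (\<integral>\<^sup>+ s'. cost_from A s' (map (restrict_day P) days1) + X
              \<partial>observe A s (map ((!) c) P))
         \<partial>decide A (inner b) (map ((!) x) P))"
        unfolding case_prod_unfold
        using le[OF b'(1)] by (intro nn_integral_pmf_mono add_left_mono) (simp add: b'(2))
      also have "\<dots> = cost_from A (inner b) (map (restrict_day P) (d # days1)) + X"
        by (simp add: case_prod_unfold nn_integral_add_const_pmf' d restrict_day_def
            add.assoc[symmetric])
      finally show ?thesis .
    qed
    have "\<exists>T'. experts_instance n T' days"
      using Cons.prems by (auto simp: experts_instance_Cons)
    then obtain T' where T': "experts_instance n T' days" ..
    \<comment> \<open>Case 1 is impossible. In cases 2 and 3 the set is kept, in 4 and 5 it is
      rejected later. Where no further day lies before the end (2) or the rejection (4), the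
      required non-rejection is that of \<open>past @ [d]\<close>.\<close>
    from Cons.IH[OF T', of "past @ [d]"] show ?thesis
    proof (elim disjE exE conjE, goal_cases)
      case 3
      then have "\<not> rejects \<delta> P (past @ d # days)" by simp
      with 3 step'[of _ days 0] show ?case by simp
    next
      case 2
      with False step'[of _ days 0] show ?case by simp
    next
      case 1
      then show ?case by simp
    next
      case (4 days1 d' days2)
      then show ?case using step'[of _ "days1 @ [d']"]
        by (intro disjI2 exI[of _ "d # days1"] exI[of _ d'] exI[of _ days2]) (auto simp: False)
    next
      case (5 days1 d' days2)
      then show ?case using step'[of _ "days1 @ [d']"]
        by (intro disjI2 exI[of _ "d # days1"] exI[of _ d'] exI[of _ days2]) auto
    qed
  qed
qed

definition cost_with_pool ::
    "nat \<Rightarrow> nat \<Rightarrow> real \<Rightarrow> ('s, 'p) expert_alg \<Rightarrow> nat \<Rightarrow> 'p day list \<Rightarrow> nat set \<Rightarrow> ennreal" where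
  "cost_with_pool n k \<delta> A t days P =
     (\<integral>\<^sup>+ s. cost_from (B_alg n k \<delta> A)
        \<lparr>pool = sorted_list_of_set P, loss = replicate k 0, since = t, today = t, inner = s\<rparr> days
      \<partial>start A)"

lemma cost_after_draw_eq:
  "cost_after_draw n k \<delta> A t days =
     (\<integral>\<^sup>+ P. cost_with_pool n k \<delta> A t days P \<partial>pmf_of_set {P. P \<subseteq> {..<n} \<and> card P = k})"
  by (simp add: cost_after_draw_def B_fresh_def cost_with_pool_def)

lemma cost_B_alg: "cost (B_alg n k \<delta> A) days = cost_after_draw n k \<delta> A 0 days"
  by (simp add: cost_def cost_after_draw_def)

text \<open>The phase bound is integrated over the initial state of the black box; the same
  rejection day serves all of these states.\<close>

lemma B_phase:
  fixes A :: "('s, 'p) expert_alg" and days :: "'p day list"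
  assumes "experts_instance n T days" "P \<subseteq> {..<n}" "card P = k"
  obtains
    (kept) "days = [] \<or> \<not> rejects \<delta> (sorted_list_of_set P) days"
      "cost_with_pool n k \<delta> A t days P \<le> cost A (map (restrict_day (sorted_list_of_set P)) days)"
  | (rejected) days1 d days2 where "days = days1 @ d # days2"
      "rejects \<delta> (sorted_list_of_set P) (days1 @ [d])"
      "days1 = [] \<or> \<not> rejects \<delta> (sorted_list_of_set P) days1"
      "cost_with_pool n k \<delta> A t days P
         \<le> cost A (map (restrict_day (sorted_list_of_set P)) (days1 @ [d]))
            + cost_after_draw n k \<delta> A (t + length (days1 @ [d])) days2"
proof -
  let ?P = "sorted_list_of_set P"
  have fin: "finite P" using assms(2) by (rule finite_subset) simp
  define b where "b s = \<lparr>pool = ?P, loss = replicate k 0, since = t, today = t, inner = s\<rparr>" for s :: 's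
  have b: "B_tracks ?P t ([] :: 'p day list) (b s)" "inner (b s) = s" for s
    using fin assms(3) by (auto simp: B_tracks_def b_def intro!: nth_equalityI)
  have set: "set ?P \<subseteq> {..<n}" using fin assms(2) by simp
  have G: "cost_with_pool n k \<delta> A t days P = (\<integral>\<^sup>+ s. cost_from (B_alg n k \<delta> A) (b s) days \<partial>start A)"
    by (simp add: cost_with_pool_def b_def)
  from B_phase_from[OF assms(1) set, of "[]" \<delta> t k A]
  consider (1) "days = [] \<or> \<not> rejects \<delta> ?P days"
      "\<And>b. B_tracks ?P t ([] :: 'p day list) b \<Longrightarrow> cost_from (B_alg n k \<delta> A) b days
         \<le> cost_from A (inner b) (map (restrict_day ?P) days)"
    | (2) days1 d days2 where "days = days1 @ d # days2" "rejects \<delta> ?P (days1 @ [d])"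
      "days1 = [] \<or> \<not> rejects \<delta> ?P days1"
      "\<And>b. B_tracks ?P t ([] :: 'p day list) b \<Longrightarrow> cost_from (B_alg n k \<delta> A) b days
         \<le> cost_from A (inner b) (map (restrict_day ?P) (days1 @ [d]))
            + cost_after_draw n k \<delta> A (t + length (days1 @ [d])) days2"
    by auto
  then show ?thesis
  proof cases
    case 1
    have "cost_with_pool n k \<delta> A t days P \<le> cost A (map (restrict_day ?P) days)"
      unfolding G cost_def using 1(2)[OF b(1)] by (intro nn_integral_pmf_mono) (simp add: b(2))
    with 1(1) show ?thesis by (rule that(1))
  next
    case (2 days1 d days2)
    have "cost_with_pool n k \<delta> A t days P
         \<le> cost A (map (restrict_day ?P) (days1 @ [d]))
            + cost_after_draw n k \<delta> A (t + length (days1 @ [d])) days2"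
      unfolding G cost_def nn_integral_add_const_pmf'[symmetric]
      using 2(4)[OF b(1)] by (intro nn_integral_pmf_mono) (simp add: b(2))
    with 2(1-3) show ?thesis by (rule that(2))
  qed
qed

section \<open>Bad days\<close>

definition bad_start :: "real \<Rightarrow> nat \<Rightarrow> 'p day list \<Rightarrow> bool" where
  "bad_start \<delta> i days \<longleftrightarrow>
     (\<exists>m. 1 \<le> m \<and> m \<le> length days \<and> expert_cost (take m days) i > \<delta> / 8 * real m)"

fun bad_days :: "real \<Rightarrow> nat \<Rightarrow> 'p day list \<Rightarrow> nat" where
  "bad_days \<delta> i [] = 0"
| "bad_days \<delta> i (d # days) = (if bad_start \<delta> i (d # days) then 1 else 0) + bad_days \<delta> i days"

text \<open>Badness looks forward only: the days of \<open>days'\<close> keep their status whatever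
  precedes them.\<close>

lemma bad_days_append_le: "bad_days \<delta> i (days @ days') \<le> length days + bad_days \<delta> i days'"
  by (induction days) auto

lemma bad_days_append_ge: "bad_days \<delta> i days' \<le> bad_days \<delta> i (days @ days')"
  by (induction days) auto

text \<open>The bad first day lies before \<open>days'\<close> and is counted on top of it. In the
  application \<open>d\<close> is the rejection day, which ends the phase begun on that first
  day.\<close>

lemma bad_days_bad_start:
  assumes "bad_start \<delta> i (days @ d # days')"
  shows "Suc (bad_days \<delta> i days') \<le> bad_days \<delta> i (days @ d # days')"
proof (cases days)
  case Nil
  then show ?thesis using assms by simp
next
  case (Cons e days1)
  then show ?thesis
    using assms bad_days_append_ge[of \<delta> i days' "days1 @ [d]"] by simp
qed

text \<open>A one-sided maximal inequality: the prefixes that witness bad days are peeled off greedily.\<close>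

lemma bad_days_le_expert_cost:
  assumes "experts_instance n T days" "i < n"
  shows "\<delta> / 8 * real (bad_days \<delta> i days) \<le> expert_cost days i"
proof (cases "0 \<le> \<delta>")
  case False
  then have "\<delta> / 8 * real (bad_days \<delta> i days) \<le> 0" by (simp add: mult_le_0_iff)
  then show ?thesis using expert_cost_nonneg[OF assms] by linarith
next
  case True
  from assms(1) show ?thesis
  proof (induction days arbitrary: T rule: length_induct)
    case (1 days)
    show ?case
    proof (cases days)
      case Nil
      then show ?thesis by simp
    next
      case (Cons d days')
      show ?thesis
      proof (cases "bad_start \<delta> i days")
        case False
        have "0 \<le> snd d ! i" "\<exists>T'. experts_instance n T' days'"
          using 1(2) assms(2) by (auto simp: Cons experts_instance_Cons)
        with 1(1) False show ?thesis by (fastforce simp: Cons)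
      next
        case True
        \<comment> \<open>The cost of these \<open>m\<close> days pays \<delta>/8 for each of them,
          bad or not, so counting can resume after the whole prefix.\<close>
        then obtain m where m: "1 \<le> m" "m \<le> length days"
          "expert_cost (take m days) i > \<delta> / 8 * real m"
          by (auto simp: bad_start_def)
        have "\<exists>T'. experts_instance n T' (drop m days)"
          using 1(2) experts_instance_append[of n T "take m days" "drop m days"] by auto
        then have IH: "\<delta> / 8 * real (bad_days \<delta> i (drop m days)) \<le> expert_cost (drop m days) i"
          using 1(1) m by auto
        have "bad_days \<delta> i days \<le> m + bad_days \<delta> i (drop m days)"
          using bad_days_append_le[of \<delta> i "take m days" "drop m days"] m(2) by simp
        then have "\<delta> / 8 * real (bad_days \<delta> i days) \<le> \<delta> / 8 * (real m + real (bad_days \<delta> i (drop m days)))"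
          using \<open>0 \<le> \<delta>\<close> by (intro mult_left_mono) auto
        also have "\<dots> \<le> expert_cost (take m days) i + expert_cost (drop m days) i"
          using m(3) IH by (simp add: distrib_left)
        finally show ?thesis by (simp flip: expert_cost_append)
      qed
    qed
  qed
qed

text \<open>The phase itself is the witnessing period. Conversely, a set containing \<open>i\<close>
  survives if drawn on a day that is not bad.\<close>

lemma rejects_imp_bad_start:
  assumes "rejects \<delta> P days1" "days1 \<noteq> []" "i \<in> set P"
  shows "bad_start \<delta> i (days1 @ days2)"
  unfolding bad_start_def
  using assms by (intro exI[of _ "length days1"])
    (auto simp: rejects_def Suc_le_eq pos_less_divide_eq mult.commute)

text \<open>Some member averages at most \<delta>/8, and any member will do if there are no days.
  Comparison with it costs 3/2 * \<delta>/8 = 3/16 \<delta> per day.\<close>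

lemma pool_cost_le:
  assumes "sequential_prediction_alg \<beta> A" "experts_instance n T days" "set P \<subseteq> {..<n}"
    and "1 \<le> length P" "days = [] \<or> \<not> rejects \<delta> P days"
  shows "cost (A (length P) (1/2)) (map (restrict_day P) days)
     \<le> ennreal (3/16 * \<delta> * real (length days) + 2 * \<beta> * ln (real (length P)))" (is ?A)
    and "\<exists>j<length P. expert_cost days (P ! j) \<le> \<delta> / 8 * real (length days)"
proof -
  show ex: "\<exists>j<length P. expert_cost days (P ! j) \<le> \<delta> / 8 * real (length days)"
  proof (cases "days = []")
    case True
    then show ?thesis using assms(4) by (auto intro!: exI[of _ 0])
  next
    case False
    then obtain p where "p \<in> set P" "expert_cost days p / real (length days) \<le> \<delta> / 8"
      using assms(5) by (auto simp: rejects_def not_less)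
    with False show ?thesis by (auto simp: in_set_conv_nth pos_divide_le_eq)
  qed
  then obtain j where j: "j < length P" "expert_cost days (P ! j) \<le> \<delta> / 8 * real (length days)"
    by blast
  note sequential_prediction_cost_le[OF assms(1,4) experts_instance_restrict[OF assms(2,3)] j(1)]
  also have "ennreal (3 / 2 * expert_cost (map (restrict_day P) days) j + 2 * \<beta> * ln (real (length P)))
     \<le> ennreal (3/16 * \<delta> * real (length days) + 2 * \<beta> * ln (real (length P)))"
    using j by (intro ennreal_leI) (simp add: expert_cost_restrict_day)
  finally show ?A .
qed

text \<open>The good member is known only for the days before the rejection. Replacing all costs of
  the last day by 0 keeps its total cost, and by \<open>cost_last_day\<close> the black box loses at
  most 1 by this change.\<close>

lemma pool_cost_last_day_le:
  assumes "sequential_prediction_alg \<beta> A" "experts_instance n T (days @ [d])" "set P \<subseteq> {..<n}"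
    and "1 \<le> length P" "days = [] \<or> \<not> rejects \<delta> P days" "0 \<le> \<delta>"
  shows "cost (A (length P) (1/2)) (map (restrict_day P) (days @ [d]))
     \<le> ennreal (3/16 * \<delta> * real (length (days @ [d])) + 2 * \<beta> * ln (real (length P)) + 1)"
proof -
  obtain x c where d: "d = (x, c)" by force
  define d' where "d' = (x, replicate (length c) (0::real))"
  have inst: "experts_instance n T (days @ [d'])"
    and day: "length c = n" "\<forall>r \<in> set c. 0 \<le> r \<and> r \<le> 1"
    using assms(2) by (auto simp: experts_instance_append experts_instance_Cons d d'_def)
  have inst1: "\<exists>T'. experts_instance n T' days"
    using assms(2) by (auto simp: experts_instance_append)
  have c: "map ((!) (replicate (length c) (0::real))) P = replicate (length P) 0"
    using assms(3) day(1) by (intro nth_equalityI) (auto simp: subset_iff)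
  have c1: "\<forall>r \<in> set (map ((!) c) P). r \<le> 1"
    using assms(3) day by (auto simp: subset_iff)
  obtain j where j: "j < length P" "expert_cost days (P ! j) \<le> \<delta> / 8 * real (length days)"
    using pool_cost_le(2)[OF assms(1) _ assms(3-5)] inst1 by blast
  have "P ! j < n" using j(1) assms(3) by (auto simp: subset_iff)
  then have e: "expert_cost (map (restrict_day P) (days @ [d'])) j = expert_cost days (P ! j)"
    using j(1) day(1)
    by (simp add: expert_cost_restrict_day expert_cost_append d'_def del: map_append)
  have "cost (A (length P) (1/2)) (map (restrict_day P) (days @ [d]))
      \<le> cost (A (length P) (1/2)) (map (restrict_day P) (days @ [d'])) + 1"
    using cost_last_day[OF c1, of "A (length P) (1/2)" "map (restrict_day P) days" "map ((!) x) P"]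
    by (simp add: d d'_def restrict_day_def c)
  also have "\<dots> \<le> ennreal (3 / 2 * expert_cost days (P ! j) + 2 * \<beta> * ln (real (length P))) + 1"
    using sequential_prediction_cost_le[OF assms(1,4) experts_instance_restrict[OF inst assms(3)] j(1)]
    by (intro add_right_mono) (simp only: e)
  also have "\<dots> = ennreal (3 / 2 * expert_cost days (P ! j) + 2 * \<beta> * ln (real (length P)) + 1)"
    using assms(1,4) \<open>P ! j < n\<close> inst1
    by (subst ennreal_plus)
      (auto simp: sequential_prediction_alg_def intro!: add_nonneg_nonneg expert_cost_nonneg)
  also have "\<dots> \<le> ennreal (3/16 * \<delta> * real (length (days @ [d])) + 2 * \<beta> * ln (real (length P)) + 1)"
    using j(2) assms(6) by (intro ennreal_leI) (simp add: algebra_simps)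
  finally show ?thesis .
qed

section \<open>Expected cost after a draw\<close>

lemma set_pmf_random_subset:
  assumes "k \<le> n"
  shows "set_pmf (pmf_of_set {P. P \<subseteq> {..<n} \<and> card P = k}) = {P. P \<subseteq> {..<n} \<and> card P = k}"
proof (rule set_pmf_of_set)
  show "{P. P \<subseteq> {..<n} \<and> card P = k} \<noteq> {}"
    using obtain_subset_with_card_n[of k "{..<n}"] assms by auto
  show "finite {P. P \<subseteq> {..<n} \<and> card P = k}"
    by (rule finite_subset[of _ "Pow {..<n}"]) auto
qed

text \<open>These are the subsets of size k of n - 1 elements, and (n - k) (n choose k) = n (n - 1
  choose k).\<close>

lemma card_subsets_avoiding:
  assumes "i < n" "k \<le> n"
  shows "real (card {P. P \<subseteq> {..<n} \<and> card P = k \<and> i \<notin> P}) = (1 - real k / real n) * real (n choose k)"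
proof -
  have "{P. P \<subseteq> {..<n} \<and> card P = k \<and> i \<notin> P} = {P. P \<subseteq> {..<n} - {i} \<and> card P = k}"
    by auto
  then have "card {P. P \<subseteq> {..<n} \<and> card P = k \<and> i \<notin> P} = (n - 1) choose k"
    using assms by (simp add: n_subsets)
  moreover have "real (n - k) * real (n choose k) = real n * real ((n - 1) choose k)"
    using binomial_absorb_comp[of n k] by (simp only: flip: of_nat_mult)
  ultimately show ?thesis
    using assms by (simp add: field_simps of_nat_diff)
qed

lemma nn_integral_random_subset:
  assumes "i < n" "k \<le> n" "0 \<le> X" "0 \<le> Y"
  shows "(\<integral>\<^sup>+ P. ennreal (if i \<in> P then X else Y) \<partial>pmf_of_set {P. P \<subseteq> {..<n} \<and> card P = k})
    = ennreal (real k / real n * X + (1 - real k / real n) * Y)"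
proof -
  define S where "S = {P. P \<subseteq> {..<n} \<and> card P = k}"
  have fin: "finite S" unfolding S_def by (rule finite_subset[of _ "Pow {..<n}"]) auto
  have card: "card S = n choose k" by (simp add: S_def n_subsets)
  then have pos: "0 < real (card S)" using assms by simp
  then have ne: "S \<noteq> {}" by auto
  have out: "real (card {P \<in> S. i \<notin> P}) = (1 - real k / real n) * real (card S)"
    using card_subsets_avoiding[OF assms(1,2)] card by (simp add: S_def conj_assoc)
  have "{P \<in> S. i \<in> P} \<union> {P \<in> S. i \<notin> P} = S" by auto
  then have "card {P \<in> S. i \<in> P} + card {P \<in> S. i \<notin> P} = card S"
    using fin by (subst card_Un_disjoint[symmetric]) auto
  then have "in": "real (card {P \<in> S. i \<in> P}) = real k / real n * real (card S)"
    using out by (simp add: algebra_simps flip: of_nat_add)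
  have "(\<Sum>P\<in>S. if i \<in> P then X else Y) = real (card {P \<in> S. i \<in> P}) * X + real (card {P \<in> S. i \<notin> P}) * Y"
    using fin by (simp add: sum.If_cases Int_def conj_commute)
  also have "\<dots> = (real k / real n * X + (1 - real k / real n) * Y) * real (card S)"
    by (simp add: "in" out algebra_simps)
  finally have sum: "(\<Sum>P\<in>S. if i \<in> P then X else Y) / real (card S)
      = real k / real n * X + (1 - real k / real n) * Y"
    using pos by simp
  have "(\<integral>\<^sup>+ P. ennreal (if i \<in> P then X else Y) \<partial>pmf_of_set S) =
      (\<Sum>P\<in>S. ennreal (if i \<in> P then X else Y)) / ennreal (real (card S))"
    using ne fin by (simp add: nn_integral_pmf_of_set ennreal_of_nat_eq_real_of_nat del: sum_ennreal)
  also have "\<dots> = ennreal ((\<Sum>P\<in>S. if i \<in> P then X else Y) / real (card S))"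
    using pos assms by (subst sum_ennreal) (auto intro!: divide_ennreal sum_nonneg)
  also have "\<dots> = ennreal (real k / real n * X + (1 - real k / real n) * Y)"
    by (simp only: sum)
  finally show ?thesis by (simp only: S_def)
qed

text \<open>The potential charges every bad draw for one restart of the black box and one rejection
  day. A draw that is not bad is the last one as soon as it contains expert \<open>i\<close>, so that the
  expected number of these is at most \<open>n / k\<close>, all but the last of which are rejected.\<close>

lemma cost_after_draw_le:
  fixes days :: "'p day list"
  assumes "sequential_prediction_alg \<beta> A" "experts_instance n T days" "i < n" "1 \<le> k" "k \<le> n" "0 \<le> \<delta>"
  defines "a \<equiv> 2 * \<beta> * ln (real k)"
  shows "cost_after_draw n k \<delta> (A k (1/2)) t days \<le>
    ennreal (3/16 * \<delta> * real (length days) + real (bad_days \<delta> i days) * (a + 1)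
      + a * (real n / real k) + (real n / real k - 1))"
  using assms(2)
proof (induction days arbitrary: t T rule: length_induct)
  case (1 days)
  note prev = 1(1) and inst = 1(2)
  \<comment> \<open>\<open>n / k\<close> is the expected number of draws until one contains
    \<open>i\<close>: each pays the start-up cost \<open>a\<close>, and all but the last pay 1 for
    the rejection day.\<close>
  define W where "W = a * (real n / real k) + (real n / real k - 1)"
  define \<Phi> where "\<Phi> days = 3/16 * \<delta> * real (length days) + real (bad_days \<delta> i days) * (a + 1) + W" for days :: "'p day list"
  have nk: "1 \<le> real n / real k" using assms(4,5) by simp
  have a: "0 \<le> a" using assms(1,4) by (simp add: a_def sequential_prediction_alg_def)
  have W: "0 \<le> W" "a \<le> W"
    using a nk mult_left_mono[OF nk a] by (auto simp: W_def)
  have IH: "cost_after_draw n k \<delta> (A k (1/2)) t' days' \<le> ennreal (\<Phi> days')"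
    if "days = days1 @ d # days'" for t' days1 d days'
  proof -
    have "length days' < length days" "\<exists>T'. experts_instance n T' days'"
      using that inst by (auto simp: experts_instance_append experts_instance_Cons)
    with prev show ?thesis by (auto simp: \<Phi>_def W_def add.assoc)
  qed
  have kept: "cost_with_pool n k \<delta> (A k (1/2)) t days P \<le> ennreal (3/16 * \<delta> * real (length days) + a) \<or>
      (\<exists>days1 d days2. days = days1 @ d # days2 \<and> rejects \<delta> (sorted_list_of_set P) (days1 @ [d]) \<and>
        cost_with_pool n k \<delta> (A k (1/2)) t days P
          \<le> ennreal (3/16 * \<delta> * real (length (days1 @ [d])) + a + 1 + \<Phi> days2))"
    if P: "P \<subseteq> {..<n}" "card P = k" for P
  proof -
    let ?P = "sorted_list_of_set P"
    have fin: "finite P" using P(1) by (rule finite_subset) simp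
    have PL: "set ?P \<subseteq> {..<n}" "1 \<le> length ?P" "length ?P = k"
      using fin P assms(4) by auto
    show ?thesis
    proof (cases rule: B_phase[OF inst P, where \<delta> = \<delta> and t = t and A = "A k (1/2)"])
      case 1
      then show ?thesis
        using pool_cost_le(1)[OF assms(1) inst PL(1,2) 1(1)]
        unfolding PL(3) a_def[symmetric] by (meson order_trans)
    next
      case (2 days1 d days2)
      have "\<exists>T'. experts_instance n T' ((days1 @ [d]) @ days2)"
        using inst 2(1) by auto
      then have "\<exists>T'. experts_instance n T' (days1 @ [d])"
        by (subst (asm) experts_instance_append) blast
      then have "cost (A k (1/2)) (map (restrict_day ?P) (days1 @ [d])) \<le>
          ennreal (3/16 * \<delta> * real (length (days1 @ [d])) + a + 1)"
        using pool_cost_last_day_le[OF assms(1) _ PL(1,2) 2(3) assms(6)]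
        unfolding PL(3) a_def by blast
      with 2(4) IH[OF 2(1)]
      have "cost_with_pool n k \<delta> (A k (1/2)) t days P \<le>
          ennreal (3/16 * \<delta> * real (length (days1 @ [d])) + a + 1) + ennreal (\<Phi> days2)"
        by (meson add_mono order_trans)
      also have "\<dots> = ennreal (3/16 * \<delta> * real (length (days1 @ [d])) + a + 1 + \<Phi> days2)"
        using a W assms(6) by (intro ennreal_plus[symmetric]) (auto simp: \<Phi>_def)
      finally show ?thesis using 2(1,2) by blast
    qed
  qed
  note S = set_pmf_random_subset[OF assms(5)]
  show ?case
  proof (cases "bad_start \<delta> i days")
    case True
    \<comment> \<open>On a bad day the bound holds for every set, without any probability: a
      rejection lowers \<open>bad_days\<close> by at least one, which releases
      \<open>a + 1\<close>.\<close>
    have "cost_with_pool n k \<delta> (A k (1/2)) t days P \<le> ennreal (\<Phi> days)"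
      if P: "P \<subseteq> {..<n}" "card P = k" for P
      using kept[OF P]
    proof (elim disjE exE conjE)
      assume "cost_with_pool n k \<delta> (A k (1/2)) t days P \<le> ennreal (3/16 * \<delta> * real (length days) + a)"
      also have "\<dots> \<le> ennreal (\<Phi> days)"
        using W(2) a by (intro ennreal_leI) (simp add: \<Phi>_def add_increasing)
      finally show ?thesis .
    next
      fix days1 d days2
      assume days: "days = days1 @ d # days2"
      have "real (Suc (bad_days \<delta> i days2)) * (a + 1) \<le> real (bad_days \<delta> i days) * (a + 1)"
        using bad_days_bad_start[of \<delta> i days1 d days2] True a
        by (intro mult_right_mono) (simp_all add: days)
      then have le: "3/16 * \<delta> * real (length (days1 @ [d])) + a + 1 + \<Phi> days2 \<le> \<Phi> days"
        by (simp add: \<Phi>_def days algebra_simps add_divide_distrib)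
      assume "cost_with_pool n k \<delta> (A k (1/2)) t days P
          \<le> ennreal (3/16 * \<delta> * real (length (days1 @ [d])) + a + 1 + \<Phi> days2)"
      also have "\<dots> \<le> ennreal (\<Phi> days)" by (rule ennreal_leI[OF le])
      finally show ?thesis .
    qed
    then show ?thesis
      unfolding cost_after_draw_eq
      by (intro nn_integral_pmf_le_const) (simp add: S \<Phi>_def W_def add.assoc)
  next
    case False
    \<comment> \<open>A set containing \<open>i\<close> is kept to the end, so \<open>X\<close> has
      a single start-up cost. \<open>Y\<close> allows in addition for a rejection day and for the
      share \<open>W\<close> of the draws after it.\<close>
    define X where "X = 3/16 * \<delta> * real (length days) + real (bad_days \<delta> i days) * (a + 1) + a"
    define Y where "Y = X + 1 + W"
    have X: "0 \<le> X" using a assms(6) by (simp add: X_def)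
    have Y: "0 \<le> Y" using X W by (simp add: Y_def)
    have "cost_with_pool n k \<delta> (A k (1/2)) t days P \<le> ennreal (if i \<in> P then X else Y)"
      if P: "P \<subseteq> {..<n}" "card P = k" for P
      using kept[OF P]
    proof (elim disjE exE conjE)
      assume "cost_with_pool n k \<delta> (A k (1/2)) t days P \<le> ennreal (3/16 * \<delta> * real (length days) + a)"
      also have "\<dots> \<le> ennreal (if i \<in> P then X else Y)"
        using W a by (intro ennreal_leI) (simp add: X_def Y_def)
      finally show ?thesis .
    next
      fix days1 d days2
      assume days: "days = days1 @ d # days2" and rej: "rejects \<delta> (sorted_list_of_set P) (days1 @ [d])"
      have "finite P" using P(1) by (rule finite_subset) simp
      then have i: "i \<notin> P"
        using rejects_imp_bad_start[OF rej, of i days2] False by (auto simp: days)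
      have "real (bad_days \<delta> i days2) * (a + 1) \<le> real (bad_days \<delta> i days) * (a + 1)"
        using bad_days_append_ge[of \<delta> i days2 "days1 @ [d]"] a
        by (intro mult_right_mono) (simp_all add: days)
      then have le: "3/16 * \<delta> * real (length (days1 @ [d])) + a + 1 + \<Phi> days2 \<le> Y"
        by (simp add: \<Phi>_def X_def Y_def days algebra_simps add_divide_distrib)
      assume "cost_with_pool n k \<delta> (A k (1/2)) t days P
          \<le> ennreal (3/16 * \<delta> * real (length (days1 @ [d])) + a + 1 + \<Phi> days2)"
      also have "\<dots> \<le> ennreal Y" by (rule ennreal_leI[OF le])
      finally show ?thesis using i by simp
    qed
    then have "cost_after_draw n k \<delta> (A k (1/2)) t days
        \<le> (\<integral>\<^sup>+ P. ennreal (if i \<in> P then X else Y) \<partial>pmf_of_set {P. P \<subseteq> {..<n} \<and> card P = k})"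
      unfolding cost_after_draw_eq by (intro nn_integral_pmf_mono) (simp add: S)
    also have "\<dots> = ennreal (real k / real n * X + (1 - real k / real n) * Y)"
      by (rule nn_integral_random_subset[OF assms(3,5) X Y])
    \<comment> \<open>\<open>W\<close> is the solution of W = a + (1 - k/n) (1 + W).\<close>
    also have "real k / real n * X + (1 - real k / real n) * Y = X - a + W"
      using assms(3,4) by (simp add: Y_def W_def field_simps)
    finally show ?thesis by (simp add: X_def W_def add.assoc)
  qed
qed

text \<open>Within a phase the black box runs on a genuine instance, so it follows members of its
  set and is charged at most 1 per day. This settles \<delta> \<ge> 1.\<close>

lemma cost_after_draw_le_length:
  assumes "sequential_prediction_alg \<beta> A" "experts_instance n T days" "1 \<le> k" "k \<le> n"
  shows "cost_after_draw n k \<delta> (A k (1/2)) t days \<le> ennreal (real T)"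
  using assms(2)
proof (induction days arbitrary: t T rule: length_induct)
  case (1 days)
  note prev = 1(1) and inst = 1(2)
  note S = set_pmf_random_subset[OF assms(4)]
  have "cost_with_pool n k \<delta> (A k (1/2)) t days P \<le> ennreal (real T)"
    if P: "P \<subseteq> {..<n}" "card P = k" for P
  proof -
    let ?P = "sorted_list_of_set P"
    have fin: "finite P" using P(1) by (rule finite_subset) simp
    have PL: "set ?P \<subseteq> {..<n}" "length ?P = k"
      using fin P by auto
    have pool: "cost (A k (1/2)) (map (restrict_day ?P) days') \<le> ennreal (real T')"
      if "experts_instance n T' days'" for days' T'
      using experts_instance_restrict[OF that PL(1)]
        cost_le_length[OF _ sequential_prediction_follows[OF assms(1,3)]] PL(2) by blast
    show ?thesis
    proof (cases rule: B_phase[OF inst P, where \<delta> = \<delta> and t = t and A = "A k (1/2)"])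
      case 1
      then show ?thesis using pool[OF inst] by (auto intro: order_trans)
    next
      case (2 days1 d days2)
      have "experts_instance n T ((days1 @ [d]) @ days2)"
        using inst 2(1) by simp
      then obtain T1 T2 where T: "T = T1 + T2" "experts_instance n T1 (days1 @ [d])"
        "experts_instance n T2 days2"
        unfolding experts_instance_append[of _ _ "days1 @ [d]"] by blast
      have "cost_after_draw n k \<delta> (A k (1/2)) (t + length (days1 @ [d])) days2 \<le> ennreal (real T2)"
        using prev 2(1) T(3) by auto
      with 2(4) pool[OF T(2)]
      have "cost_with_pool n k \<delta> (A k (1/2)) t days P \<le> ennreal (real T1) + ennreal (real T2)"
        by (meson add_mono order_trans)
      then show ?thesis by (simp add: T(1) ennreal_plus)
    qed
  qed
  then show ?case
    unfolding cost_after_draw_eq by (intro nn_integral_pmf_le_const) (simp add: S)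
qed

section \<open>Space\<close>

text \<open>The space guarantee concerns complete runs, whereas Algorithm B abandons the black box
  midway; the recorded days tell on which instance a state occurs.\<close>

inductive reachable :: "('s, 'p) expert_alg \<Rightarrow> 'p day list \<Rightarrow> 's \<Rightarrow> bool" for A where
  reachable_start: "s \<in> set_pmf (start A) \<Longrightarrow> reachable A [] s"
| reachable_step: "reachable A days s \<Longrightarrow> (i, s') \<in> set_pmf (decide A s x) \<Longrightarrow>
    s'' \<in> set_pmf (observe A s' c) \<Longrightarrow> reachable A (days @ [(x, c)]) s''"

text \<open>The last past day is moved to the front of \<open>days'\<close>, which extends the run
  backwards until it begins in a start state.\<close>

lemma reachable_play:
  assumes "reachable A days s" "(is, ss) \<in> set_pmf (play_from A s days')"
  shows "\<exists>is' ss'. (is', ss') \<in> set_pmf (play A (days @ days')) \<and> set ss \<subseteq> set ss'"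
  using assms
proof (induction arbitrary: "is" ss days' rule: reachable.induct)
  case (reachable_start s)
  then show ?case by (auto simp: play_def)
next
  case (reachable_step days s i s' x s'' c)
  have "(i # is, s # s' # ss) \<in> set_pmf (play_from A s ((x, c) # days'))"
    using reachable_step.hyps(2,3) reachable_step.prems by force
  from reachable_step.IH[OF this] show ?case by fastforce
qed

lemma reachable_words:
  assumes "\<And>T days. experts_instance k T days \<Longrightarrow> uses_space A days S"
    and "reachable A days s" "experts_instance k T days"
  shows "real (words A s) \<le> S"
    and "(i, s') \<in> set_pmf (decide A s x) \<Longrightarrow> length x = k \<Longrightarrow> real (words A s') \<le> S"
proof -
  show "real (words A s) \<le> S"
    using reachable_play[OF assms(2), of "[]" "[s]" "[]"] assms(1)[OF assms(3)]
    by (fastforce simp: uses_space_def)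
next
  assume s': "(i, s') \<in> set_pmf (decide A s x)" and x: "length x = k"
  \<comment> \<open>A state between decision and observation occurs only in runs that finish the
    day; zero costs finish it.\<close>
  define c where "c = replicate k (0::real)"
  obtain s'' where "s'' \<in> set_pmf (observe A s' c)"
    using set_pmf_not_empty[of "observe A s' c"] by blast
  with s' have "([i], [s, s', s'']) \<in> set_pmf (play_from A s [(x, c)])"
    by force
  then obtain is' ss' where play: "(is', ss') \<in> set_pmf (play A (days @ [(x, c)]))" "s' \<in> set ss'"
    using reachable_play[OF assms(2)] by fastforce
  have "experts_instance k (Suc T) (days @ [(x, c)])"
    using assms(3) x by (auto simp: experts_instance_def c_def)
  from assms(1)[OF this] play show "real (words A s') \<le> S"
    by (fastforce simp: uses_space_def)
qed

definition B_reachable :: "nat \<Rightarrow> nat \<Rightarrow> ('s, 'p) expert_alg \<Rightarrow> 's B_state \<Rightarrow> bool" where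
  "B_reachable n k A b \<longleftrightarrow> length (pool b) = k \<and> length (loss b) = k \<and> set (pool b) \<subseteq> {..<n} \<and>
     (\<exists>T days. experts_instance k T days \<and> reachable A days (inner b))"

lemma B_fresh_reachable:
  assumes "k \<le> n" "b \<in> set_pmf (B_fresh n k A t)"
  shows "B_reachable n k A b"
proof -
  obtain P s where P: "P \<subseteq> {..<n}" "card P = k" and s: "s \<in> set_pmf (start A)"
    and b: "b = \<lparr>pool = sorted_list_of_set P, loss = replicate k 0, since = t, today = t, inner = s\<rparr>"
    using assms by (auto simp: B_fresh_def set_pmf_random_subset)
  have "finite P" using P(1) by (rule finite_subset) simp
  moreover have "experts_instance k 0 []" by (simp add: experts_instance_def)
  ultimately show ?thesis
    using P s by (auto simp: B_reachable_def b intro: reachable_start)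
qed

text \<open>Besides the black box, \<open>B_words\<close> counts the pool twice, the losses once,
  and six counters and parameters.\<close>

lemma B_alg_words_from:
  assumes "\<And>T days. experts_instance k T days \<Longrightarrow> uses_space A days S" "k \<le> n"
  shows "B_reachable n k A b \<Longrightarrow> experts_instance n T days \<Longrightarrow>
    (is, ss) \<in> set_pmf (play_from (B_alg n k \<delta> A) b days) \<Longrightarrow> s \<in> set ss \<Longrightarrow>
    real (B_words A s) \<le> S + 3 * real k + 6"
proof (induction days arbitrary: b T "is" ss)
  case Nil
  then show ?case
    using reachable_words(1)[OF assms(1)] by (fastforce simp: B_reachable_def B_words_def)
next
  case (Cons d days)
  obtain x c where d: "d = (x, c)" by force
  let ?x = "map ((!) x) (pool b)" and ?c = "map ((!) c) (pool b)"
  obtain T' past where past: "experts_instance k T' past" "reachable A past (inner b)"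
    and len: "length (pool b) = k" "length (loss b) = k" "set (pool b) \<subseteq> {..<n}"
    using Cons.prems(1) by (auto simp: B_reachable_def)
  have inst: "length c = n" "\<forall>r \<in> set c. 0 \<le> r \<and> r \<le> 1" "\<exists>T''. experts_instance n T'' days"
    using Cons.prems(2) by (auto simp: experts_instance_Cons d)
  have "\<exists>j s' b'' is' ss'. (j, s') \<in> set_pmf (decide A (inner b) ?x) \<and>
      b'' \<in> set_pmf (B_observe n k \<delta> A (b\<lparr>inner := s'\<rparr>) c) \<and>
      (is', ss') \<in> set_pmf (play_from (B_alg n k \<delta> A) b'' days) \<and>
      ss = b # b\<lparr>inner := s'\<rparr> # ss'"
    using Cons.prems(3) by (fastforce simp: d B_decide_def)
  then obtain j s' b'' is' ss' where s': "(j, s') \<in> set_pmf (decide A (inner b) ?x)"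
    and b'': "b'' \<in> set_pmf (B_observe n k \<delta> A (b\<lparr>inner := s'\<rparr>) c)"
    and play: "(is', ss') \<in> set_pmf (play_from (B_alg n k \<delta> A) b'' days)"
    and ss: "ss = b # b\<lparr>inner := s'\<rparr> # ss'" by blast
  have "B_reachable n k A b''"
  \<comment> \<open>A state outside the support of a fresh draw must come from the branch without
    rejection.\<close>
  proof (cases "b'' \<in> set_pmf (B_fresh n k A (Suc (today b)))")
    case True
    then show ?thesis by (rule B_fresh_reachable[OF assms(2)])
  next
    case False
    then obtain s'' where s'': "s'' \<in> set_pmf (observe A s' ?c)"
      and b: "b'' = b\<lparr>inner := s'', loss := map2 (+) (loss b) ?c, today := Suc (today b)\<rparr>"
      using b'' by (auto simp: B_observe_def Let_def split: if_splits)
    have "\<forall>r \<in> set ?c. 0 \<le> r \<and> r \<le> 1"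
      using len(3) inst(1,2) by (auto simp: subset_iff)
    then have "experts_instance k (Suc T') (past @ [(?x, ?c)])"
      using past(1) len(1) by (auto simp: experts_instance_def)
    moreover have "reachable A (past @ [(?x, ?c)]) s''"
      by (rule reachable_step[OF past(2) s' s''])
    ultimately show ?thesis
      using len by (auto simp: B_reachable_def b)
  qed
  moreover obtain T'' where "experts_instance n T'' days" using inst(3) by blast
  ultimately have IH: "s \<in> set ss' \<Longrightarrow> real (B_words A s) \<le> S + 3 * real k + 6"
    using Cons.IH play by blast
  have "real (B_words A b) \<le> S + 3 * real k + 6"
    using reachable_words(1)[OF assms(1) past(2,1)] len by (simp add: B_words_def)
  moreover have "real (B_words A (b\<lparr>inner := s'\<rparr>)) \<le> S + 3 * real k + 6"
    using reachable_words(2)[OF assms(1) past(2,1) s'] len by (simp add: B_words_def)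
  ultimately show ?case
    using Cons.prems(4) IH by (auto simp: ss)
qed

lemma B_alg_uses_space:
  assumes "\<And>T days. experts_instance k T days \<Longrightarrow> uses_space A days S" "k \<le> n"
    and "experts_instance n T days"
  shows "uses_space (B_alg n k \<delta> A) days (S + 3 * real k + 6)"
  using B_alg_words_from[OF assms(1,2) B_fresh_reachable[OF assms(2)] assms(3)]
  by (fastforce simp: uses_space_def play_def)

lemma uses_space_mono: "uses_space B days S \<Longrightarrow> S \<le> S' \<Longrightarrow> uses_space B days S'"
  by (fastforce simp: uses_space_def)

text \<open>Rounding up at most doubles a parameter of at least 1, and a smaller one gives sample
  size 1. Only clipping at \<open>n\<close> can push the size below the parameter.\<close>

lemma sample_size_bounds:
  assumes "2 \<le> n"
  shows "1 \<le> sample_size \<beta> n T \<delta>" "sample_size \<beta> n T \<delta> \<le> n"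
    and "sample_size \<beta> n T \<delta> = n \<or> sample_param \<beta> n T \<delta> \<le> real (sample_size \<beta> n T \<delta>)"
    and "real (sample_size \<beta> n T \<delta>) \<le>
      (if 1 \<le> sample_param \<beta> n T \<delta> then 2 * sample_param \<beta> n T \<delta> else 1)"
  using assms unfolding sample_size_def by (auto simp: min_def max_def) linarith+

section \<open>Regret\<close>

text \<open>With \<open>D = \<delta> * T\<close>, the daily term takes 3/16 of \<open>D\<close>, the
  bad draws 3/8 and the other draws 3/8, which is 15/16 in total.\<close>

lemma regret_arithmetic:
  fixes \<beta> \<delta> b :: real and n k T :: nat
  assumes \<beta>: "1 \<le> 4 * \<beta> * ln 2" and n: "2 \<le> n" and \<delta>: "\<delta> < 1"
    and D: "16 * \<beta> * (ln (real n))\<^sup>2 < \<delta> * real T"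
    and b: "0 \<le> b" "b \<le> \<delta> * real T / (16 * \<beta> * ln (real n))"
    and k: "1 \<le> k" "k \<le> n" "k = n \<or> sample_param \<beta> n T \<delta> \<le> real k"
  shows "3/16 * \<delta> * real T + b * (2 * \<beta> * ln (real k) + 1)
      + 2 * \<beta> * ln (real k) * (real n / real k) + (real n / real k - 1) \<le> \<delta> * real T"
proof -
  define L D a X where "L = ln (real n)" and "D = \<delta> * real T"
    and "a = 2 * \<beta> * ln (real k)" and "X = real n / real k"
  have ln2: "2/3 \<le> ln (2::real)" by (rule ln2_ge_two_thirds)
  have L2: "ln 2 \<le> L" using n by (simp add: L_def)
  have \<beta>0: "0 < \<beta>"
  proof (rule ccontr)
    assume "\<not> 0 < \<beta>"
    then have "4 * \<beta> * ln 2 \<le> 0" by (simp add: mult_le_0_iff)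
    with \<beta> show False by simp
  qed
  have \<beta>L: "1 \<le> 4 * \<beta> * L"
    using \<beta> mult_left_mono[OF L2, of "4 * \<beta>"] \<beta>0 by linarith
  have L: "2/3 \<le> L" using ln2 L2 by simp
  have D': "16 * \<beta> * L * L < D" using D by (simp add: L_def D_def power2_eq_square mult.assoc)
  \<comment> \<open>Four times this gives \<open>D > 2\<close>. As \<delta> < 1, this forces T \<ge>
    3 > e, so the factor \<open>ln T\<close> in the sample size is at least 1.\<close>
  have "1 * (2/3) \<le> 4 * \<beta> * L * L"
    using \<beta>L L \<beta>0 by (intro mult_mono) auto
  with D' have "2 < D" by linarith
  moreover have "D \<le> real T"
    using \<delta> mult_right_mono[of \<delta> 1 "real T"] by (simp add: D_def)
  ultimately have D0: "0 < D" and T: "3 \<le> T" by linarith+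
  have lnT: "1 \<le> ln (real T)"
    using T exp_le by (simp add: ln_ge_iff)
  have aL: "a \<le> 2 * \<beta> * L"
    using k(1,2) \<beta>0 by (simp add: a_def L_def)
  have a0: "0 \<le> a" using k(1) \<beta>0 by (simp add: a_def)
  have bD: "b \<le> D / (16 * \<beta> * L)" using b(2) by (simp add: D_def L_def)
  have pos: "0 < 16 * \<beta> * L" using \<beta>0 L by simp
  \<comment> \<open>The rejection days, at cost 1 each, become affordable through 4 \<beta> L \<ge>
    1.\<close>
  have D4: "D / (16 * \<beta> * L) \<le> D / 4"
    by (intro divide_left_mono) (use \<beta>L D0 in linarith)+
  have D8: "D / (16 * \<beta> * L) * (2 * \<beta> * L) = D / 8"
    using \<beta>0 L by simp
  have "b * a \<le> D / (16 * \<beta> * L) * (2 * \<beta> * L)"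
    using bD aL b(1) a0 D0 pos by (intro mult_mono) auto
  then have ba: "b * (a + 1) \<le> 3 / 8 * D"
    unfolding distrib_left using bD D4 D8 by linarith
  have "a * X + (X - 1) \<le> 3 / 8 * D"
  proof (cases "k = n")
    \<comment> \<open>Clipping may leave no lower bound on \<open>k\<close> in terms of
      \<open>sample_param\<close>, but the first draw already contains every expert; its start-up
      cost is paid by the lower bound on \<delta>.\<close>
    case True
    then have X: "X = 1" using n by (simp add: X_def)
    have "16 * \<beta> * L * (2/3) \<le> 16 * \<beta> * L * L"
      using L pos by (intro mult_left_mono) auto
    with D' aL D0 show ?thesis unfolding X by linarith
  next
    case False
    have sp: "16 * \<beta> * L * (real n * ln (real T)) / D \<le> real k"
      using False k(3) by (simp add: sample_param_def D_def L_def mult_ac)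
    have "16 * \<beta> * L * (real n * 1) \<le> 16 * \<beta> * L * (real n * ln (real T))"
      using lnT pos by (intro mult_left_mono) auto
    also have "\<dots> \<le> real k * D"
      using sp D0 by (simp add: pos_divide_le_eq)
    finally have X: "X \<le> D / (16 * \<beta> * L)"
      using k(1) pos by (simp add: X_def field_simps)
    have "X * a \<le> D / (16 * \<beta> * L) * (2 * \<beta> * L)"
      using X aL a0 D0 pos by (intro mult_mono) auto
    with X D4 D8 show ?thesis
      unfolding mult.commute[of a X] by linarith
  qed
  with ba D0 show ?thesis
    by (simp add: D_def a_def X_def)
qed

lemma algorithm_B_regret:
  assumes "sequential_prediction_alg \<beta> A" "2 \<le> n" "1 \<le> T" "experts_instance n T days"
    and \<delta>: "16 * \<beta> * (ln (real n))\<^sup>2 / real T < \<delta>"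
    and M: "best_cost n days \<le> \<delta>\<^sup>2 * real T / (128 * \<beta> * ln (real n))"
  shows "expected_regret (algorithm_B \<beta> n T \<delta> A) n days \<le> \<delta>"
proof -
  define k where "k = sample_size \<beta> n T \<delta>"
  note k = sample_size_bounds(1-3)[OF assms(2), of \<beta> T \<delta>, folded k_def]
  have \<beta>: "0 < \<beta>" using assms(1) by (simp add: sequential_prediction_alg_def)
  have ln: "0 < ln (real n)" using assms(2) by simp
  have "0 \<le> 16 * \<beta> * (ln (real n))\<^sup>2 / real T" using \<beta> by simp
  with \<delta> have \<delta>0: "0 < \<delta>" by linarith
  have len: "length days = T" using assms(4) by (simp add: experts_instance_def)
  have "best_cost n days \<in> expert_cost days ` {..<n}"
    unfolding best_cost_def using assms(2) by (intro Min_in) (auto simp: lessThan_empty_iff)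
  then obtain i where i: "i < n" "best_cost n days = expert_cost days i" by auto
  have best: "0 \<le> best_cost n days"
    using i expert_cost_nonneg[OF assms(4)] by simp
  have "cost (B_alg n k \<delta> (A k (1/2))) days \<le> ennreal (\<delta> * real T)"
  proof (cases "\<delta> < 1")
    case False
    have "cost (B_alg n k \<delta> (A k (1/2))) days \<le> ennreal (real T)"
      unfolding cost_B_alg by (rule cost_after_draw_le_length[OF assms(1,4) k(1,2)])
    also have "\<dots> \<le> ennreal (\<delta> * real T)"
      using False by (intro ennreal_leI mult_le_cancel_right1[THEN iffD2]) auto
    finally show ?thesis .
  next
    case True
    \<comment> \<open>Each bad day accounts for \<delta>/8 of the cost of \<open>i\<close>; dividing
      the bound on the best cost by \<delta>/8 turns 128 into 16.\<close>
    have "\<delta> / 8 * real (bad_days \<delta> i days) \<le> \<delta>\<^sup>2 * real T / (128 * \<beta> * ln (real n))"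
      using bad_days_le_expert_cost[OF assms(4) i(1), of \<delta>] M i(2) by linarith
    also have "\<dots> = \<delta> / 8 * (\<delta> * real T / (16 * \<beta> * ln (real n)))"
      by (simp add: power2_eq_square)
    finally have bad: "real (bad_days \<delta> i days) \<le> \<delta> * real T / (16 * \<beta> * ln (real n))"
      by (rule mult_left_le_imp_le) (use \<delta>0 in simp)
    have D: "16 * \<beta> * (ln (real n))\<^sup>2 < \<delta> * real T"
      using \<delta> assms(3) by (simp add: pos_divide_less_eq)
    note cost_after_draw_le[OF assms(1,4) i(1) k(1,2), of \<delta> 0]
    also have "ennreal (3/16 * \<delta> * real (length days)
        + real (bad_days \<delta> i days) * (2 * \<beta> * ln (real k) + 1)
        + 2 * \<beta> * ln (real k) * (real n / real k) + (real n / real k - 1)) \<le> ennreal (\<delta> * real T)"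
      unfolding len
      by (intro ennreal_leI regret_arithmetic sequential_prediction_constant_ge[OF assms(1)]
          assms(2) True D bad k) auto
    finally show ?thesis using \<delta>0 by (simp add: cost_B_alg)
  qed
  then show ?thesis
    unfolding algorithm_B_eq k_def[symmetric]
    using assms(3) \<delta>0 by (intro expected_regret_le[OF assms(4) _ best]) auto
qed

theorem theorem3p4:
  fixes \<beta> :: real and A :: "nat \<Rightarrow> real \<Rightarrow> ('s, 'p) expert_alg"
  assumes "sequential_prediction_alg \<beta> A"
  shows "\<exists>(C :: real) (p :: nat). \<forall>(n :: nat) (T :: nat) (\<delta> :: real) (M :: real) (days :: 'p day list).
           2 \<le> n \<longrightarrow> 1 \<le> T \<longrightarrow> experts_instance n T days \<longrightarrow>
           \<delta> > 16 * \<beta> * (ln (real n))\<^sup>2 / real T \<longrightarrow>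
           best_cost n days \<le> M \<longrightarrow>
           M \<le> \<delta>\<^sup>2 * real T / (128 * \<beta> * ln (real n)) \<longrightarrow>
             uses_space (algorithm_B \<beta> n T \<delta> A) days
               (C * (ln (real (n * T))) ^ p *
                  (if 1 \<le> sample_param \<beta> n T \<delta> then real n / (\<delta> * real T) else 1)) \<and>
             expected_regret (algorithm_B \<beta> n T \<delta> A) n days \<le> \<delta>"
proof -
  have \<beta>: "0 < \<beta>" using assms by (simp add: sequential_prediction_alg_def)
  obtain C0 where C0: "\<And>n T \<epsilon> days. 1 \<le> n \<Longrightarrow> 0 < \<epsilon> \<Longrightarrow> \<epsilon> \<le> 1/2 \<Longrightarrow> experts_instance n T days \<Longrightarrow>
      uses_space (A n \<epsilon>) days (C0 * real n)"
    using assms unfolding sequential_prediction_alg_def by blast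
  \<comment> \<open>As k \<ge> 1, \<open>K * k\<close> absorbs \<open>C0 * k + 3 * k + 6\<close>. In
    \<open>C\<close>, the summand \<open>32 * \<beta>\<close> is twice the 16 \<beta> of
    \<open>sample_param\<close>, and the other one serves a sample of size 1, where the logarithm is
    at least \<open>ln 2\<close>.\<close>
  define K where "K = \<bar>C0\<bar> + 9"
  define C where "C = K * (32 * \<beta> + 1 / (ln 2)\<^sup>2)"
  have K: "0 < K" by (simp add: K_def)
  have space: "uses_space (algorithm_B \<beta> n T \<delta> A) days
      (C * (ln (real (n * T))) ^ 2 *
        (if 1 \<le> sample_param \<beta> n T \<delta> then real n / (\<delta> * real T) else 1))"
    if n: "2 \<le> n" and T: "1 \<le> T" and days: "experts_instance n T days"
      and \<delta>: "16 * \<beta> * (ln (real n))\<^sup>2 / real T < \<delta>" for n T \<delta> and days :: "'p day list"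
  proof -
    define k where "k = sample_size \<beta> n T \<delta>"
    define N where "N = ln (real (n * T))"
    note k = sample_size_bounds(1,2,4)[OF n, of \<beta> T \<delta>, folded k_def]
    have "0 \<le> 16 * \<beta> * (ln (real n))\<^sup>2 / real T" using \<beta> by simp
    with \<delta> have \<delta>0: "0 < \<delta>" by linarith
    have "ln 2 \<le> ln (real n)" "0 \<le> ln (real T)" "N = ln (real n) + ln (real T)"
      using n T by (simp_all add: N_def ln_mult)
    moreover have "0 \<le> ln (2::real)" by simp
    ultimately have N: "ln 2 \<le> N" "ln (real n) \<le> N" "ln (real T) \<le> N" "0 \<le> N"
      by linarith+
    have N2: "(ln 2)\<^sup>2 \<le> N\<^sup>2" using N(1) by (intro power_mono) auto
    have "uses_space (algorithm_B \<beta> n T \<delta> A) days (C0 * real k + 3 * real k + 6)"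
      unfolding algorithm_B_eq k_def[symmetric]
      using B_alg_uses_space[OF C0[OF k(1)] k(2) days] by simp
    moreover have "C0 * real k + 3 * real k + 6 \<le> K * real k"
    proof -
      have "C0 * real k \<le> \<bar>C0\<bar> * real k" by (intro mult_right_mono) auto
      then show ?thesis
        unfolding K_def distrib_right using k(1) by linarith
    qed
    moreover have "K * real k \<le> C * N\<^sup>2 *
        (if 1 \<le> sample_param \<beta> n T \<delta> then real n / (\<delta> * real T) else 1)"
    proof (cases "1 \<le> sample_param \<beta> n T \<delta>")
      case True
      then have "real k \<le> 32 * \<beta> * (ln (real n) * ln (real T)) * (real n / (\<delta> * real T))"
        using k(3) by (simp add: sample_param_def mult_ac)
      \<comment> \<open>The logarithms of \<open>n\<close> and of \<open>T\<close> are each at most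
        \<open>N\<close>, whence the exponent 2.\<close>
      also have "\<dots> \<le> 32 * \<beta> * (N * N) * (real n / (\<delta> * real T))"
        using N n T \<beta> \<delta>0 by (intro mult_right_mono mult_left_mono mult_mono) auto
      also have "\<dots> \<le> (32 * \<beta> + 1 / (ln 2)\<^sup>2) * N\<^sup>2 * (real n / (\<delta> * real T))"
        using \<delta>0 by (intro mult_right_mono) (auto simp: power2_eq_square distrib_right)
      finally have "K * real k \<le> K * ((32 * \<beta> + 1 / (ln 2)\<^sup>2) * N\<^sup>2 * (real n / (\<delta> * real T)))"
        using K by (intro mult_left_mono) auto
      then show ?thesis
        using True by (simp add: C_def mult.assoc)
    next
      case False
      then have "real k \<le> 1" using k(3) by simp
      also have "1 \<le> 1 / (ln 2)\<^sup>2 * N\<^sup>2" using N2 by simp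
      also have "\<dots> \<le> (32 * \<beta> + 1 / (ln 2)\<^sup>2) * N\<^sup>2"
        using \<beta> by (intro mult_right_mono) auto
      finally show ?thesis
        using False K by (simp add: C_def mult.assoc)
    qed
    ultimately show ?thesis
      unfolding N_def by (meson order_trans uses_space_mono)
  qed
  show ?thesis
    using space algorithm_B_regret[OF assms]
    by (intro exI[of _ C] exI[of _ 2]) (blast intro: order_trans)
qed

end
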